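(* Let $Q=(Q,\cdot)$ be a quasigroup with parastrophes $Q_1,\dots,Q_5$. Then $Q,Q_1,Q_2,Q_3,Q_4,Q_5$ are pairwise non-isotopic if and only if $Q\not\sim Q$ and $Q\not\sim Q_i$ for all $i=1,2,3,4$.
   Context: $S_Q$ is the set of all permutations of the set $Q$. Quasigroups $(Q,\cdot)$ and $(Q,\circ)$ on the same set are isotopic, written $(Q,\cdot)\approx(Q,\circ)$, if there are $\alpha,\beta,\gamma\in S_Q$ with $\alpha(x)\circ\beta(y)=\gamma(x\cdot y)$ for all $x,y\in Q$. They are anti-isotopic, written $(Q,\cdot)\sim(Q,\circ)$, if there are $\alpha,\beta,\gamma\in S_Q$ with $\alpha(x)\circ\beta(y)=\gamma(y\cdot x)$ for all $x,y\in Q$. The parastrophes $Q_i=(Q,\circ_i)$, $i=1,\dots,5$, of a quasigroup $(Q,\cdot)$ are defined by: $x\circ_1 y=z\iff x\cdot z=y$; $x\circ_2 y=z\iff z\cdot y=x$; $x\circ_3 y=z\iff z\cdot x=y$; $x\circ_4 y=z\iff y\cdot z=x$; $x\circ_5 y=z\iff y\cdot x=z$. *)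

theory Defs
  imports "HOL-Combinatorics.Permutations"
begin

locale quasigroup =
  fixes Q :: "'a set" and f :: "'a \<Rightarrow> 'a \<Rightarrow> 'a"
  assumes closed: "x \<in> Q \<Longrightarrow> y \<in> Q \<Longrightarrow> f x y \<in> Q"
    and left_division: "a \<in> Q \<Longrightarrow> b \<in> Q \<Longrightarrow> \<exists>!x. x \<in> Q \<and> f a x = b"
    and right_division: "a \<in> Q \<Longrightarrow> b \<in> Q \<Longrightarrow> \<exists>!y. y \<in> Q \<and> f y a = b"

definition isotopic :: "'a set \<Rightarrow> ('a \<Rightarrow> 'a \<Rightarrow> 'a) \<Rightarrow> ('a \<Rightarrow> 'a \<Rightarrow> 'a) \<Rightarrow> bool" where
  "isotopic Q f g \<longleftrightarrow>
     (\<exists>\<alpha> \<beta> \<gamma>. \<alpha> permutes Q \<and> \<beta> permutes Q \<and> \<gamma> permutes Q \<and>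
        (\<forall>x\<in>Q. \<forall>y\<in>Q. g (\<alpha> x) (\<beta> y) = \<gamma> (f x y)))"

definition anti_isotopic :: "'a set \<Rightarrow> ('a \<Rightarrow> 'a \<Rightarrow> 'a) \<Rightarrow> ('a \<Rightarrow> 'a \<Rightarrow> 'a) \<Rightarrow> bool" where
  "anti_isotopic Q f g \<longleftrightarrow>
     (\<exists>\<alpha> \<beta> \<gamma>. \<alpha> permutes Q \<and> \<beta> permutes Q \<and> \<gamma> permutes Q \<and>
        (\<forall>x\<in>Q. \<forall>y\<in>Q. g (\<alpha> x) (\<beta> y) = \<gamma> (f y x)))"

(* Index 0 is the quasigroup itself. Only the values on Q of the parastrophes are
   meaningful, and only the indices 0 to 5; the equivalences that define the
   parastrophes are derived from unique division in the lemma parastrophe_iff below. *)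
definition parastrophe :: "'a set \<Rightarrow> ('a \<Rightarrow> 'a \<Rightarrow> 'a) \<Rightarrow> nat \<Rightarrow> 'a \<Rightarrow> 'a \<Rightarrow> 'a" where
  "parastrophe Q f i =
     [f,
      \<lambda>x y. THE z. z \<in> Q \<and> f x z = y,
      \<lambda>x y. THE z. z \<in> Q \<and> f z y = x,
      \<lambda>x y. THE z. z \<in> Q \<and> f z x = y,
      \<lambda>x y. THE z. z \<in> Q \<and> f y z = x,
      \<lambda>x y. f y x] ! i"

lemma parastrophe_0 [simp]: "parastrophe Q f 0 = f"
  by (simp add: parastrophe_def)

context quasigroup
begin

lemma the_left:
  assumes "a \<in> Q" "b \<in> Q"
  shows "(THE z. z \<in> Q \<and> f a z = b) \<in> Q"
    and "z \<in> Q \<Longrightarrow> (THE z. z \<in> Q \<and> f a z = b) = z \<longleftrightarrow> f a z = b"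
  using theI'[OF left_division[OF assms]] left_division[OF assms] by auto

lemma the_right:
  assumes "a \<in> Q" "b \<in> Q"
  shows "(THE z. z \<in> Q \<and> f z a = b) \<in> Q"
    and "z \<in> Q \<Longrightarrow> (THE z. z \<in> Q \<and> f z a = b) = z \<longleftrightarrow> f z a = b"
  using theI'[OF right_division[OF assms]] right_division[OF assms] by auto

lemma parastrophe_iff:
  assumes "x \<in> Q" "y \<in> Q" "z \<in> Q"
  shows "parastrophe Q f 1 x y = z \<longleftrightarrow> f x z = y"
    and "parastrophe Q f 2 x y = z \<longleftrightarrow> f z y = x"
    and "parastrophe Q f 3 x y = z \<longleftrightarrow> f z x = y"
    and "parastrophe Q f 4 x y = z \<longleftrightarrow> f y z = x"
    and "parastrophe Q f 5 x y = z \<longleftrightarrow> f y x = z"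
  using assms by (simp_all add: parastrophe_def the_left the_right)

lemma parastrophe_closed:
  assumes "x \<in> Q" "y \<in> Q" "i \<le> 5"
  shows "parastrophe Q f i x y \<in> Q"
proof -
  have "i = 0 \<or> i = 1 \<or> i = 2 \<or> i = 3 \<or> i = 4 \<or> i = 5"
    using \<open>i \<le> 5\<close> by linarith
  then show ?thesis
    using assms(1,2) by (auto simp: parastrophe_def the_left the_right closed)
qed

end

end

(* Two operations are isotopic iff some triple of permutations, acting coordinatewise, carries
   one graph {(x, y, z). f x y = z} onto the other. The graphs of the six parastrophes are the
   coordinate permutations of the graph of f, and permuting the coordinates of two graphs
   simultaneously preserves isotopy. Hence any isotopy between two different parastrophes can
   be turned into one from parastrophe 5, the opposite of f, to some parastrophe k < 5, which
   is an anti-isotopy from f to that parastrophe. *)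

theory Submission
  imports Defs
begin

text \<open>Stated for arbitrary ternary relations, so that the result is a coordinate on the same
  footing as the two arguments and can trade places with them.\<close>

definition relation_isotopic ::
    "'a set \<Rightarrow> ('a \<Rightarrow> 'a \<Rightarrow> 'a \<Rightarrow> bool) \<Rightarrow> ('a \<Rightarrow> 'a \<Rightarrow> 'a \<Rightarrow> bool) \<Rightarrow> bool" where
  "relation_isotopic Q R S \<longleftrightarrow>
     (\<exists>\<alpha> \<beta> \<gamma>. \<alpha> permutes Q \<and> \<beta> permutes Q \<and> \<gamma> permutes Q \<and>
        (\<forall>x\<in>Q. \<forall>y\<in>Q. \<forall>z\<in>Q. R x y z \<longleftrightarrow> S (\<alpha> x) (\<beta> y) (\<gamma> z)))"

lemma relation_isotopic_cong:
  assumes "\<And>x y z. x \<in> Q \<Longrightarrow> y \<in> Q \<Longrightarrow> z \<in> Q \<Longrightarrow> R x y z \<longleftrightarrow> R' x y z"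
    and "\<And>x y z. x \<in> Q \<Longrightarrow> y \<in> Q \<Longrightarrow> z \<in> Q \<Longrightarrow> S x y z \<longleftrightarrow> S' x y z"
  shows "relation_isotopic Q R S \<longleftrightarrow> relation_isotopic Q R' S'"
  unfolding relation_isotopic_def
  \<comment> \<open>The second hypothesis is applied at image points, which stay in
    \<open>Q\<close>.\<close>
  by (intro ex_cong1 conj_cong refl ball_cong) (simp add: assms permutes_in_image)

text \<open>Reordering the witnesses \<alpha>, \<beta>, \<gamma> in the same way gives the new
  isotopy. The five conclusions are the non-identity elements of the symmetric group on three
  coordinates.\<close>

lemma relation_isotopic_permute_coordinates:
  assumes "relation_isotopic Q R S"
  shows "relation_isotopic Q (\<lambda>x y z. R y x z) (\<lambda>x y z. S y x z)"
    and "relation_isotopic Q (\<lambda>x y z. R y z x) (\<lambda>x y z. S y z x)"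
    and "relation_isotopic Q (\<lambda>x y z. R z x y) (\<lambda>x y z. S z x y)"
    and "relation_isotopic Q (\<lambda>x y z. R x z y) (\<lambda>x y z. S x z y)"
    and "relation_isotopic Q (\<lambda>x y z. R z y x) (\<lambda>x y z. S z y x)"
  using assms unfolding relation_isotopic_def by blast+

lemma isotopic_iff_relation_isotopic:
  assumes closed: "\<And>x y. x \<in> Q \<Longrightarrow> y \<in> Q \<Longrightarrow> f x y \<in> Q"
  shows "isotopic Q f g \<longleftrightarrow> relation_isotopic Q (\<lambda>x y z. f x y = z) (\<lambda>x y z. g x y = z)"
proof -
  have "(\<forall>x\<in>Q. \<forall>y\<in>Q. g (\<alpha> x) (\<beta> y) = \<gamma> (f x y)) \<longleftrightarrow>
      (\<forall>x\<in>Q. \<forall>y\<in>Q. \<forall>z\<in>Q. f x y = z \<longleftrightarrow> g (\<alpha> x) (\<beta> y) = \<gamma> z)"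
    if "\<gamma> permutes Q" for \<alpha> \<beta> \<gamma>
    \<comment> \<open>Left to right, injectivity of \<gamma> gives the equivalence; right to left,
      take \<open>z = f x y\<close>, which lies in \<open>Q\<close>.\<close>
    using closed injD[OF permutes_inj[OF that]] by metis
  then show ?thesis
    unfolding isotopic_def relation_isotopic_def by (intro ex_cong1 conj_cong refl) blast
qed

lemma anti_isotopic_iff_isotopic_opposite:
  "anti_isotopic Q f g \<longleftrightarrow> isotopic Q (parastrophe Q f 5) g"
  by (simp add: anti_isotopic_def isotopic_def parastrophe_def)

text \<open>Written without \<open>THE\<close>, so that permuting the coordinates of one entry
  yields another entry literally.\<close>

definition parastrophe_graph :: "('a \<Rightarrow> 'a \<Rightarrow> 'a) \<Rightarrow> nat \<Rightarrow> 'a \<Rightarrow> 'a \<Rightarrow> 'a \<Rightarrow> bool" where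
  "parastrophe_graph f i =
     [\<lambda>x y z. f x y = z,
      \<lambda>x y z. f x z = y,
      \<lambda>x y z. f z y = x,
      \<lambda>x y z. f z x = y,
      \<lambda>x y z. f y z = x,
      \<lambda>x y z. f y x = z] ! i"

lemma le_5_cases:
  fixes i :: nat
  assumes "i \<le> 5"
  obtains "i = 0" | "i = 1" | "i = 2" | "i = 3" | "i = 4" | "i = 5"
  using assms by linarith

context quasigroup
begin

lemma parastrophe_eq_iff_graph:
  assumes "x \<in> Q" "y \<in> Q" "z \<in> Q" "i \<le> 5"
  shows "parastrophe Q f i x y = z \<longleftrightarrow> parastrophe_graph f i x y z"
  using \<open>i \<le> 5\<close>
  by (cases rule: le_5_cases)
    (use assms(1-3) in \<open>simp_all add: parastrophe_iff[simplified] parastrophe_graph_def\<close>)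

lemma isotopic_parastrophe_iff:
  assumes "i \<le> 5" "j \<le> 5"
  shows "isotopic Q (parastrophe Q f i) (parastrophe Q f j) \<longleftrightarrow>
         relation_isotopic Q (parastrophe_graph f i) (parastrophe_graph f j)"
proof -
  have "isotopic Q (parastrophe Q f i) (parastrophe Q f j) \<longleftrightarrow>
      relation_isotopic Q (\<lambda>x y z. parastrophe Q f i x y = z) (\<lambda>x y z. parastrophe Q f j x y = z)"
    using assms by (intro isotopic_iff_relation_isotopic parastrophe_closed)
  also have "\<dots> \<longleftrightarrow> relation_isotopic Q (parastrophe_graph f i) (parastrophe_graph f j)"
    using assms by (intro relation_isotopic_cong parastrophe_eq_iff_graph)
  finally show ?thesis .
qed

end

text \<open>The coordinate permutation that takes graph \<open>i\<close> to graph 5 is a bijection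
  on the six graphs, so it takes graph \<open>j\<close> to some graph other than 5.\<close>

lemma relation_isotopic_opposite_graph:
  assumes iso: "relation_isotopic Q (parastrophe_graph f i) (parastrophe_graph f j)"
    and "i \<le> 5" "j \<le> 5" "i \<noteq> j"
  shows "\<exists>k\<le>4. relation_isotopic Q (parastrophe_graph f 5) (parastrophe_graph f k)"
proof (rule ccontr)
  assume "\<not> ?thesis"
  then have no: "\<not> relation_isotopic Q (parastrophe_graph f 5) (parastrophe_graph f k)"
    if "k \<le> 4" for k
    using that by blast
  note no = no[of 0] no[of 1] no[of 2] no[of 3] no[of 4]
  show False
    \<comment> \<open>In each case with \<open>i\<close> and \<open>j\<close> different, exactly one
      of \<open>iso\<close> and its five permuted forms starts at graph 5, and it contradicts one
      instance of \<open>no\<close>.\<close>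
    by (rule le_5_cases[OF \<open>i \<le> 5\<close>]; rule le_5_cases[OF \<open>j \<le> 5\<close>])
      (use iso relation_isotopic_permute_coordinates[OF iso] no \<open>i \<noteq> j\<close>
        in \<open>simp_all add: parastrophe_graph_def\<close>)
qed

theorem corollary2p13:
  fixes Q :: "'a set" and f :: "'a \<Rightarrow> 'a \<Rightarrow> 'a"
  assumes "quasigroup Q f"
  shows "(\<forall>i\<in>{0..5}. \<forall>j\<in>{0..5}. i \<noteq> j \<longrightarrow>
            \<not> isotopic Q (parastrophe Q f i) (parastrophe Q f j))
         \<longleftrightarrow>
         (\<not> anti_isotopic Q f f \<and>
          (\<forall>i\<in>{1..4}. \<not> anti_isotopic Q f (parastrophe Q f i)))"
proof -
  interpret quasigroup Q f by fact
  let ?iso = "\<lambda>i j. isotopic Q (parastrophe Q f i) (parastrophe Q f j)"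
  \<comment> \<open>Since parastrophe 0 is \<open>f\<close>, the separate condition on
    \<open>f\<close> itself becomes the case \<open>k = 0\<close>.\<close>
  have "{0..4} = insert 0 {1..4::nat}" by auto
  then have "(\<not> anti_isotopic Q f f \<and> (\<forall>i\<in>{1..4}. \<not> anti_isotopic Q f (parastrophe Q f i)))
      \<longleftrightarrow> (\<forall>k\<in>{0..4}. \<not> ?iso 5 k)"
    by (simp add: anti_isotopic_iff_isotopic_opposite)
  moreover have "\<exists>k\<le>4. ?iso 5 k" if "?iso i j" "i \<le> 5" "j \<le> 5" "i \<noteq> j" for i j
  proof -
    have "\<exists>k\<le>4. relation_isotopic Q (parastrophe_graph f 5) (parastrophe_graph f k)"
      using relation_isotopic_opposite_graph[of Q f i j] that
      by (simp add: isotopic_parastrophe_iff)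
    then show ?thesis by (auto simp: isotopic_parastrophe_iff)
  qed
  \<comment> \<open>Conversely, 5 and any \<open>k\<close> \<le> 4 are themselves a pair of
    different indices.\<close>
  ultimately show ?thesis by fastforce
qed

end
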